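(* Let $K$ be a field and let $(E,C)$ be a separated graph with $|E^0|=1$. Then there is an isomorphism of $K$-algebras $$L_K(E,C)\;\cong\; \mathop{*}_{X\in C} L_K(|X|),$$ that is, $L_K(E,C)$ is the free product over $K$ (the coproduct of unital $K$-algebras) of the Leavitt algebras $L_K(|X|)$ of type $(1,|X|)$, for $X\in C$.
   Context: A graph is a directed graph $E=(E^0,E^1,s,r)$ with $E^0$ a nonempty set of vertices, $E^1$ a set of edges (no finiteness or countability assumptions), and source and range maps $s,r:E^1\to E^0$. A separated graph is a pair $(E,C)$ where $C=\bigsqcup_{v\in E^0}C_v$ and, for each $v$, $C_v$ is a partition of $s^{-1}(v)$ into pairwise disjoint nonempty subsets ($C_v=\emptyset$ if $v$ is a sink). The Leavitt path algebra $L_K(E,C)$ is the associative $K$-algebra with generators $\{v,e,e^*\mid v\in E^0,\ e\in E^1\}$ and relations: (V) $vv'=\delta_{v,v'}v$ for $v,v'\in E^0$; (E1) $s(e)e=er(e)=e$ for $e\in E^1$; (E2) $r(e)e^*=e^*s(e)=e^*$ for $e\in E^1$; (SCK1) $e^*e'=\delta_{e,e'}r(e)$ for all $e,e'\in X$, $X\in C$; (SCK2) $v=\sum_{e\in X}ee^*$ for every finite set $X\in C_v$, $v\in E^0$. For a (nonzero) cardinal number $\aleph$, $L_K(\aleph)$ denotes the Leavitt algebra of type $(1,\aleph)$, namely the Leavitt path algebra $L_K(F,D)$ where $F$ is the graph with one vertex and $\aleph$ edges and $D=\{F^1\}$ (a single set). When there is just one vertex $v$, that vertex is the identity element of the algebra.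 *)

theory Defs
  imports
    "HOL-Algebra.QuotRing"
    "HOL-Algebra.Module"
    "HOL-Library.Disjoint_Sets"
    "HOL-Library.Function_Algebras"
    "Graph_Theory.Digraph"
begin

section \<open>Algebras over a field\<close>

text \<open>
  The ground field is a type \<open>'k :: field\<close>.  An associative \<open>'k\<close>-algebra is a record of type
  \<open>('k, 'a) module\<close>, which carries addition, multiplication and scalar multiplication.
  A Leavitt path algebra need not have an identity when the graph has infinitely many vertices, so
  ideals and quotients are set up without using an identity; this is why \<open>genideal\<close>, which lives
  in the locale of unital rings, is not used.
\<close>

inductive_set algebra_ideal :: "('k, 'a) module \<Rightarrow> 'a set \<Rightarrow> 'a set"
  for A :: "('k, 'a) module" and S :: "'a set"
  where
    generator: "x \<in> S \<Longrightarrow> x \<in> algebra_ideal A S"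
  | zero: "\<zero>\<^bsub>A\<^esub> \<in> algebra_ideal A S"
  | add: "x \<in> algebra_ideal A S \<Longrightarrow> y \<in> algebra_ideal A S \<Longrightarrow> x \<oplus>\<^bsub>A\<^esub> y \<in> algebra_ideal A S"
  | smult: "x \<in> algebra_ideal A S \<Longrightarrow> c \<odot>\<^bsub>A\<^esub> x \<in> algebra_ideal A S"
  | left: "x \<in> algebra_ideal A S \<Longrightarrow> a \<in> carrier A \<Longrightarrow> a \<otimes>\<^bsub>A\<^esub> x \<in> algebra_ideal A S"
  | right: "x \<in> algebra_ideal A S \<Longrightarrow> a \<in> carrier A \<Longrightarrow> x \<otimes>\<^bsub>A\<^esub> a \<in> algebra_ideal A S"

definition quotient_algebra :: "('k, 'a) module \<Rightarrow> 'a set \<Rightarrow> ('k, 'a set) module" where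
  "quotient_algebra A I =
     ring.extend (A Quot I) (module.fields (\<lambda>c X. \<Union>x\<in>X. I +>\<^bsub>A\<^esub> (c \<odot>\<^bsub>A\<^esub> x)))"

text \<open>Isomorphisms of unital algebras: \<open>ring_iso\<close> includes preservation of the identity.\<close>

definition algebra_isomorphic :: "('k, 'a) module \<Rightarrow> ('k, 'b) module \<Rightarrow> bool"
    (infix \<open>\<cong>\<^sub>a\<^sub>l\<^sub>g\<close> 50) where
  "A \<cong>\<^sub>a\<^sub>l\<^sub>g B \<longleftrightarrow>
     (\<exists>h \<in> ring_iso A B. \<forall>c. \<forall>x \<in> carrier A. h (c \<odot>\<^bsub>A\<^esub> x) = c \<odot>\<^bsub>B\<^esub> h x)"


section \<open>Free algebras\<close>

text \<open>
  An element of the free algebra on a set of letters is a finitely supported function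
  from words to scalars.
\<close>

definition word :: "'g list \<Rightarrow> 'g list \<Rightarrow> 'k::field" where
  "word u = (\<lambda>w. if w = u then 1 else 0)"

definition scale :: "'k::field \<Rightarrow> ('g list \<Rightarrow> 'k) \<Rightarrow> 'g list \<Rightarrow> 'k" where
  "scale c f = (\<lambda>w. c * f w)"

definition convolution :: "('g list \<Rightarrow> 'k::field) \<Rightarrow> ('g list \<Rightarrow> 'k) \<Rightarrow> 'g list \<Rightarrow> 'k" where
  "convolution f g = (\<lambda>w. \<Sum>i\<le>length w. f (take i w) * g (drop i w))"

text \<open>
  The set \<open>W\<close> of admissible words is meant to be closed under concatenation: \<open>lists G\<close> gives the
  free unital algebra on \<open>G\<close> and \<open>lists G - {[]}\<close> the free non-unital algebra on \<open>G\<close>,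
  where the field \<open>one\<close> has no meaning.
\<close>

definition word_algebra :: "'g list set \<Rightarrow> ('k::field, 'g list \<Rightarrow> 'k) module" where
  "word_algebra W =
     \<lparr>carrier = {f. finite {w. f w \<noteq> 0} \<and> {w. f w \<noteq> 0} \<subseteq> W},
      mult = convolution, one = word [], zero = 0, add = (+), smult = scale\<rparr>"


section \<open>Free products of unital algebras\<close>

text \<open>
  The free product (coproduct of unital algebras) of the family \<open>A i\<close> for \<open>i \<in> I\<close>:
  a letter \<open>(i, a)\<close> stands for \<open>a \<in> A i\<close>, and the relations say precisely that
  each \<open>a \<mapsto> (i, a)\<close> is a homomorphism of unital algebras.
\<close>

inductive_set free_product_rels ::
    "'i set \<Rightarrow> ('i \<Rightarrow> ('k::field, 'a) module) \<Rightarrow> (('i \<times> 'a) list \<Rightarrow> 'k) set"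
  for I :: "'i set" and A :: "'i \<Rightarrow> ('k::field, 'a) module"
  where
    add: "i \<in> I \<Longrightarrow> a \<in> carrier (A i) \<Longrightarrow> b \<in> carrier (A i) \<Longrightarrow>
      word [(i, a \<oplus>\<^bsub>A i\<^esub> b)] - (word [(i, a)] + word [(i, b)]) \<in> free_product_rels I A"
  | smult: "i \<in> I \<Longrightarrow> a \<in> carrier (A i) \<Longrightarrow>
      word [(i, c \<odot>\<^bsub>A i\<^esub> a)] - scale c (word [(i, a)]) \<in> free_product_rels I A"
  | mult: "i \<in> I \<Longrightarrow> a \<in> carrier (A i) \<Longrightarrow> b \<in> carrier (A i) \<Longrightarrow>
      word [(i, a \<otimes>\<^bsub>A i\<^esub> b)] - word [(i, a), (i, b)] \<in> free_product_rels I A"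
  | one: "i \<in> I \<Longrightarrow> word [(i, \<one>\<^bsub>A i\<^esub>)] - word [] \<in> free_product_rels I A"

definition free_product ::
    "'i set \<Rightarrow> ('i \<Rightarrow> ('k::field, 'a) module) \<Rightarrow> ('k, (('i \<times> 'a) list \<Rightarrow> 'k) set) module" where
  "free_product I A =
     (let F = word_algebra (lists (SIGMA i:I. carrier (A i)))
      in quotient_algebra F (algebra_ideal F (free_product_rels I A)))"


section \<open>Leavitt path algebras of separated graphs\<close>

text \<open>
  Source and range are \<open>tail\<close> and \<open>head\<close>; \<open>out_arcs E v\<close> is the inverse image of \<open>v\<close> under the
  source map.  The members of distinct \<open>C v\<close> are automatically distinct, being nonempty sets of
  edges with different sources.
\<close>

locale separated_graph = wf_digraph E
  for E :: "('v, 'e) pre_digraph" +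
  fixes C :: "'v \<Rightarrow> 'e set set"
  assumes verts_nonempty: "verts E \<noteq> {}"
    and partition: "v \<in> verts E \<Longrightarrow> partition_on (out_arcs E v) (C v)"

datatype ('v, 'e) lpa_gen = Vert 'v | Edge 'e | Ghost 'e

definition lpa_gens :: "('v, 'e) pre_digraph \<Rightarrow> ('v, 'e) lpa_gen set" where
  "lpa_gens E = Vert ` verts E \<union> Edge ` arcs E \<union> Ghost ` arcs E"

inductive_set lpa_rels ::
    "('v, 'e) pre_digraph \<Rightarrow> ('v \<Rightarrow> 'e set set) \<Rightarrow> (('v, 'e) lpa_gen list \<Rightarrow> 'k::field) set"
  for E :: "('v, 'e) pre_digraph" and C :: "'v \<Rightarrow> 'e set set"
  where
    V: "v \<in> verts E \<Longrightarrow> v' \<in> verts E \<Longrightarrow>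
      word [Vert v, Vert v'] - (if v = v' then word [Vert v] else 0) \<in> lpa_rels E C"
  | E1_source: "e \<in> arcs E \<Longrightarrow> word [Vert (tail E e), Edge e] - word [Edge e] \<in> lpa_rels E C"
  | E1_range: "e \<in> arcs E \<Longrightarrow> word [Edge e, Vert (head E e)] - word [Edge e] \<in> lpa_rels E C"
  | E2_range: "e \<in> arcs E \<Longrightarrow> word [Vert (head E e), Ghost e] - word [Ghost e] \<in> lpa_rels E C"
  | E2_source: "e \<in> arcs E \<Longrightarrow> word [Ghost e, Vert (tail E e)] - word [Ghost e] \<in> lpa_rels E C"
  | SCK1: "v \<in> verts E \<Longrightarrow> X \<in> C v \<Longrightarrow> e \<in> X \<Longrightarrow> e' \<in> X \<Longrightarrow>
      word [Ghost e, Edge e'] - (if e = e' then word [Vert (head E e)] else 0) \<in> lpa_rels E C"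
  | SCK2: "v \<in> verts E \<Longrightarrow> X \<in> C v \<Longrightarrow> finite X \<Longrightarrow>
      word [Vert v] - (\<Sum>e\<in>X. word [Edge e, Ghost e]) \<in> lpa_rels E C"

text \<open>
  The field \<open>one\<close> is the class of the sum of all vertices; this is the identity element when there
  are finitely many vertices, and has no meaning otherwise.
\<close>

definition leavitt_path_algebra ::
    "('v, 'e) pre_digraph \<Rightarrow> ('v \<Rightarrow> 'e set set) \<Rightarrow>
     ('k::field, (('v, 'e) lpa_gen list \<Rightarrow> 'k) set) module" where
  "leavitt_path_algebra E C =
     (let F = word_algebra (lists (lpa_gens E) - {[]});
          I = algebra_ideal F (lpa_rels E C)
      in (quotient_algebra F I)\<lparr>one := I +>\<^bsub>F\<^esub> (\<Sum>v\<in>verts E. word [Vert v])\<rparr>)"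

text \<open>
  A cardinal number \<open>\<kappa>\<close> is given as a cardinal order \<open>'a rel\<close>, with \<open>card_of X\<close> for the
  cardinality of \<open>X\<close>; the graph with one vertex and \<open>\<kappa>\<close> edges has edge set \<open>Field \<kappa>\<close>.
\<close>

definition rose :: "'a rel \<Rightarrow> (unit, 'a) pre_digraph" where
  "rose \<kappa> = \<lparr>verts = {()}, arcs = Field \<kappa>, tail = (\<lambda>_. ()), head = (\<lambda>_. ())\<rparr>"

definition leavitt_algebra ::
    "'a rel \<Rightarrow> ('k::field, ((unit, 'a) lpa_gen list \<Rightarrow> 'k) set) module" where
  "leavitt_algebra \<kappa> = leavitt_path_algebra (rose \<kappa>) (\<lambda>_. {Field \<kappa>})"

lemma separated_graph_rose:
  assumes "Field \<kappa> \<noteq> {}"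
  shows "separated_graph (rose \<kappa>) (\<lambda>_. {Field \<kappa>})"
  using assms
  by unfold_locales (auto simp: rose_def out_arcs_def partition_on_def disjoint_def)

end

theory Submission
  imports Defs
begin

text \<open>
  Both sides of the isomorphism are given by generators and relations, so each is determined by the
  homomorphisms out of it, and the proof compares these.

  Let \<open>v\<close> be the only vertex.  Relations (V), (E1) and (E2) then say exactly that \<open>v\<close> is an
  identity element, and the remaining relations (SCK1) and (SCK2) each involve the edges of a single
  block \<open>X \<in> C v\<close>.  Hence a unital homomorphism from the Leavitt path algebra to an algebra \<open>B\<close> is the
  same as a choice, independently for every block \<open>X\<close>, of elements of \<open>B\<close> that satisfy the relations
  of the block (a \<open>leavitt_family\<close>; see \<open>lpa_hom\<close>, \<open>lpa_hom_unique\<close>).  The Leavitt algebra of type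
  \<open>(1, |X|)\<close> is the case of a graph with the single block \<open>X\<close>, so such a choice is also the same as
  one homomorphism from that Leavitt algebra to \<open>B\<close> for every \<open>X\<close>; and by the universal property of
  the free product (\<open>free_product_hom\<close>, \<open>free_product_hom_unique\<close>) these homomorphisms
  amount to a single one from the free product to \<open>B\<close>.

  The two universal properties yield homomorphisms in both directions, and their uniqueness parts show
  that the two composites are identities.  The universal properties are obtained uniformly from one
  construction: \<open>algebra_presentation\<close> treats quotients of an algebra of words, where the empty
  word may be absent and the identity is any element that acts as one modulo the relations.
\<close>

section \<open>The convolution algebra of words\<close>

lemma scale_one [simp]: "scale 1 f = f"
  and scale_minus_one: "scale (- 1) f = - f"
  and scale_zero_right [simp]: "scale c 0 = 0"
  and scale_scale: "scale c (scale d f) = scale (c * d) f"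
  and scale_add_right: "scale c (f + g) = scale c f + scale c g"
  and scale_diff_right: "scale c (f - g) = scale c f - scale c g"
  and scale_add_left: "scale (c + d) f = scale c f + scale d f"
  by (auto simp: scale_def fun_eq_iff algebra_simps)

lemma convolution_add_left: "convolution (f + g) h = convolution f h + convolution g h"
  and convolution_add_right: "convolution f (g + h) = convolution f g + convolution f h"
  and convolution_diff_left: "convolution (f - g) h = convolution f h - convolution g h"
  and convolution_diff_right: "convolution f (g - h) = convolution f g - convolution f h"
  and convolution_zero_left [simp]: "convolution 0 h = 0"
  and convolution_zero_right [simp]: "convolution f 0 = 0"
  by (auto simp: convolution_def fun_eq_iff algebra_simps sum.distrib sum_subtractf)

lemma convolution_scale_left: "convolution (scale c f) g = scale c (convolution f g)"
  and convolution_scale_right: "convolution f (scale c g) = scale c (convolution f g)"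
  by (auto simp: convolution_def scale_def fun_eq_iff sum_distrib_left algebra_simps)

lemma convolution_word:
  "convolution (word u) (word v) = (word (u @ v) :: 'g list \<Rightarrow> 'k::field)"
proof
  fix w
  have "word u (take i w) * word v (drop i w) =
      (if i = length u \<and> w = u @ v then 1 else 0 :: 'k)" if "i \<le> length w" for i
  proof -
    have "word u (take i w) * word v (drop i w) =
        (if take i w = u \<and> drop i w = v then 1 else 0 :: 'k)"
      by (simp add: word_def)
    also have "take i w = u \<and> drop i w = v \<longleftrightarrow> i = length u \<and> w = u @ v"
    proof
      assume "take i w = u \<and> drop i w = v"
      with that show "i = length u \<and> w = u @ v"
        by (metis append_take_drop_id length_take min.absorb2)
    qed simp
    finally show ?thesis .
  qed
  then have "convolution (word u) (word v) w =
      (\<Sum>i\<le>length w. if i = length u then if w = u @ v then 1 else 0 else 0 :: 'k)"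
    unfolding convolution_def by (intro sum.cong refl) (simp only: atMost_iff if_if_eq_conj)
  also have "\<dots> = word (u @ v) w"
    by (auto simp: word_def)
  finally show "convolution (word u) (word v) w = (word (u @ v) w :: 'k)" .
qed

text \<open>
  Both sides sum over the ways to cut \<open>w\<close> into three pieces; a pair of cut positions is recorded
  on the left by the positions themselves and on the right by the lengths of the first two pieces.
\<close>

lemma convolution_assoc:
  fixes f g h :: "'g list \<Rightarrow> 'k::field"
  shows "convolution (convolution f g) h = convolution f (convolution g h)"
proof
  fix w :: "'g list"
  let ?n = "length w"
  have "convolution (convolution f g) h w =
      (\<Sum>i\<le>?n. \<Sum>j\<le>i. f (take j w) * g (drop j (take i w)) * h (drop i w))"
    unfolding convolution_def
    by (intro sum.cong) (auto simp: sum_distrib_right min_def)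
  also have "\<dots> = (\<Sum>(i, j)\<in>(SIGMA i:{..?n}. {..i}).
      f (take j w) * g (drop j (take i w)) * h (drop i w))"
    by (simp add: sum.Sigma)
  also have "\<dots> = (\<Sum>(j, k)\<in>(SIGMA j:{..?n}. {..?n - j}).
      f (take j w) * (g (take k (drop j w)) * h (drop k (drop j w))))"
    by (rule sum.reindex_bij_witness
          [where i = "\<lambda>(j, k). (j + k, j)" and j = "\<lambda>(i, j). (j, i - j)"])
      (auto simp: drop_take mult.assoc)
  also have "\<dots> = (\<Sum>j\<le>?n. \<Sum>k\<le>?n - j.
      f (take j w) * (g (take k (drop j w)) * h (drop k (drop j w))))"
    by (simp add: sum.Sigma)
  also have "\<dots> = convolution f (convolution g h) w"
    unfolding convolution_def by (intro sum.cong) (auto simp: sum_distrib_left)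
  finally show "convolution (convolution f g) h w = convolution f (convolution g h) w" .
qed

lemma convolution_nonzeroE:
  assumes "convolution f g w \<noteq> 0"
  obtains u v where "w = u @ v" "f u \<noteq> 0" "g v \<noteq> 0"
proof -
  from assms obtain i where "f (take i w) * g (drop i w) \<noteq> 0"
    unfolding convolution_def using sum.neutral by meson
  then show ?thesis using that [of "take i w" "drop i w"] by auto
qed

lemma word_algebra_simps [simp]:
  "zero (word_algebra W) = 0" "add (word_algebra W) = (+)"
  "mult (word_algebra W) = convolution" "one (word_algebra W) = word []"
  "smult (word_algebra W) = scale"
  by (simp_all add: word_algebra_def)

lemma mem_carrier_word_algebra:
  "f \<in> carrier (word_algebra W) \<longleftrightarrow> finite {w. f w \<noteq> 0} \<and> {w. f w \<noteq> 0} \<subseteq> W"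
  by (simp add: word_algebra_def)

lemma carrier_word_algebra_mono:
  "W \<subseteq> W' \<Longrightarrow> f \<in> carrier (word_algebra W) \<Longrightarrow> f \<in> carrier (word_algebra W')"
  by (auto simp: mem_carrier_word_algebra)

lemma word_algebra_zero [simp]: "0 \<in> carrier (word_algebra W)"
  by (simp add: mem_carrier_word_algebra)

lemma word_algebra_scale: "f \<in> carrier (word_algebra W) \<Longrightarrow> scale c f \<in> carrier (word_algebra W)"
  by (auto simp: mem_carrier_word_algebra scale_def)

lemma word_algebra_add:
  assumes "f \<in> carrier (word_algebra W)" "g \<in> carrier (word_algebra W)"
  shows "f + g \<in> carrier (word_algebra W)"
proof -
  have "{w. (f + g) w \<noteq> 0} \<subseteq> {w. f w \<noteq> 0} \<union> {w. g w \<noteq> 0}"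
    by auto
  with assms show ?thesis
    unfolding mem_carrier_word_algebra by (meson finite_Un finite_subset subset_trans Un_least)
qed

lemma word_algebra_uminus: "f \<in> carrier (word_algebra W) \<Longrightarrow> - f \<in> carrier (word_algebra W)"
  using word_algebra_scale [of f W "- 1"] by (simp add: scale_minus_one)

lemma word_algebra_diff:
  "f \<in> carrier (word_algebra W) \<Longrightarrow> g \<in> carrier (word_algebra W) \<Longrightarrow>
    f - g \<in> carrier (word_algebra W)"
  using word_algebra_add [of f W "- g"] word_algebra_uminus [of g W] by simp

lemma word_algebra_word [simp]: "word w \<in> carrier (word_algebra W :: ('k::field, _) module) \<longleftrightarrow> w \<in> W"
proof -
  have "{x. word w x \<noteq> (0 :: 'k)} = {w}"
    by (auto simp: word_def)
  then show ?thesis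
    by (simp add: mem_carrier_word_algebra)
qed

lemma word_algebra_sum:
  "(\<And>x. x \<in> X \<Longrightarrow> f x \<in> carrier (word_algebra W)) \<Longrightarrow> sum f X \<in> carrier (word_algebra W)"
  by (induction X rule: infinite_finite_induct) (auto intro: word_algebra_add)

lemma word_algebra_convolution:
  assumes "\<And>u v. u \<in> W \<Longrightarrow> v \<in> W \<Longrightarrow> u @ v \<in> W"
    and "f \<in> carrier (word_algebra W)" "g \<in> carrier (word_algebra W)"
  shows "convolution f g \<in> carrier (word_algebra W)"
proof -
  have "{w. convolution f g w \<noteq> 0} \<subseteq> (\<lambda>(u, v). u @ v) ` ({w. f w \<noteq> 0} \<times> {w. g w \<noteq> 0})"
    by (auto elim!: convolution_nonzeroE)
  moreover have "finite \<dots>" "\<dots> \<subseteq> W"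
    using assms by (auto simp: mem_carrier_word_algebra)
  ultimately show ?thesis
    unfolding mem_carrier_word_algebra by (meson finite_subset subset_trans)
qed

text \<open>
  A linear property of elements needs to be checked on words only.
\<close>

lemma word_algebra_induct [consumes 1, case_names zero add]:
  fixes f :: "'g list \<Rightarrow> 'k::field"
  assumes "f \<in> carrier (word_algebra W)"
    and zero: "P 0"
    and add: "\<And>c w f. w \<in> W \<Longrightarrow> f \<in> carrier (word_algebra W) \<Longrightarrow> P f \<Longrightarrow> P (scale c (word w) + f)"
  shows "P f"
  using assms(1)
proof (induction "card {w. f w \<noteq> 0}" arbitrary: f)
  case 0
  then have "f = 0"
    by (auto simp: mem_carrier_word_algebra fun_eq_iff)
  with zero show ?case by (simp only:)
next
  case (Suc n)
  then obtain w where w: "f w \<noteq> 0"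
    by (metis (mono_tags, lifting) Collect_empty_eq card.empty nat.distinct(1))
  let ?g = "f(w := 0)"
  have supp: "{x. ?g x \<noteq> 0} = {x. f x \<noteq> 0} - {w}"
    by auto
  have "?g \<in> carrier (word_algebra W)"
    using Suc.prems supp by (auto simp: mem_carrier_word_algebra)
  moreover have "card {x. ?g x \<noteq> 0} = n"
    using supp w Suc by (simp add: mem_carrier_word_algebra)
  ultimately have "P (scale (f w) (word w) + ?g)"
    using Suc w by (intro add) (auto simp: mem_carrier_word_algebra)
  also have "scale (f w) (word w) + ?g = f"
    by (auto simp: fun_eq_iff scale_def word_def)
  finally show ?case .
qed

lemma convolution_word_Nil_left [simp]: "convolution (word []) f = f"
proof
  fix w
  have "convolution (word []) f w = (\<Sum>i\<le>length w. if i = 0 then f w else 0)"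
    unfolding convolution_def by (intro sum.cong) (auto simp: word_def)
  then show "convolution (word []) f w = f w" by simp
qed

lemma convolution_word_Nil_right [simp]: "convolution f (word []) = f"
proof
  fix w
  have "convolution f (word []) w = (\<Sum>i\<le>length w. if i = length w then f w else 0)"
    unfolding convolution_def by (intro sum.cong) (auto simp: word_def)
  then show "convolution f (word []) w = f w" by simp
qed


section \<open>Unital algebras and evaluation of words\<close>

text \<open>
  From here on, elements of word algebras are manipulated algebraically; their values at words
  should not be unfolded by the simplifier.
\<close>

declare zero_fun_apply [simp del] plus_fun_apply [simp del] minus_apply [simp del]
  uminus_apply [simp del]

locale unital_algebra = ring A for A :: "('k::field, 'a) module" (structure) +
  assumes smult_closed [simp, intro]: "x \<in> carrier A \<Longrightarrow> c \<odot> x \<in> carrier A"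
    and smult_one [simp]: "x \<in> carrier A \<Longrightarrow> 1 \<odot> x = x"
    and smult_smult: "x \<in> carrier A \<Longrightarrow> c \<odot> (d \<odot> x) = (c * d) \<odot> x"
    and smult_add_left: "x \<in> carrier A \<Longrightarrow> (c + d) \<odot> x = c \<odot> x \<oplus> d \<odot> x"
    and smult_add_right: "x \<in> carrier A \<Longrightarrow> y \<in> carrier A \<Longrightarrow> c \<odot> (x \<oplus> y) = c \<odot> x \<oplus> c \<odot> y"
    and smult_mult_left: "x \<in> carrier A \<Longrightarrow> y \<in> carrier A \<Longrightarrow> (c \<odot> x) \<otimes> y = c \<odot> (x \<otimes> y)"
    and smult_mult_right: "x \<in> carrier A \<Longrightarrow> y \<in> carrier A \<Longrightarrow> x \<otimes> (c \<odot> y) = c \<odot> (x \<otimes> y)"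
begin

lemma smult_zero_left [simp]: "x \<in> carrier A \<Longrightarrow> 0 \<odot> x = \<zero>"
  using smult_add_left [of x 0 0] by (metis add.inv_closed add.r_cancel_one' add.m_closed smult_closed add_0)

lemma smult_zero_right [simp]: "c \<odot> \<zero> = \<zero>"
  using smult_smult [of \<zero> c 0] by simp

end

definition algebra_hom :: "('k, 'a) module \<Rightarrow> ('k, 'b) module \<Rightarrow> ('a \<Rightarrow> 'b) set" where
  "algebra_hom A B =
     {h \<in> ring_hom A B. \<forall>c. \<forall>x \<in> carrier A. h (c \<odot>\<^bsub>A\<^esub> x) = c \<odot>\<^bsub>B\<^esub> h x}"

lemma algebra_homI:
  assumes "\<And>x. x \<in> carrier A \<Longrightarrow> h x \<in> carrier B"
    and "\<And>x y. x \<in> carrier A \<Longrightarrow> y \<in> carrier A \<Longrightarrow> h (x \<otimes>\<^bsub>A\<^esub> y) = h x \<otimes>\<^bsub>B\<^esub> h y"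
    and "\<And>x y. x \<in> carrier A \<Longrightarrow> y \<in> carrier A \<Longrightarrow> h (x \<oplus>\<^bsub>A\<^esub> y) = h x \<oplus>\<^bsub>B\<^esub> h y"
    and "h \<one>\<^bsub>A\<^esub> = \<one>\<^bsub>B\<^esub>"
    and "\<And>c x. x \<in> carrier A \<Longrightarrow> h (c \<odot>\<^bsub>A\<^esub> x) = c \<odot>\<^bsub>B\<^esub> h x"
  shows "h \<in> algebra_hom A B"
  unfolding algebra_hom_def using assms by (auto intro!: ring_hom_memI)

lemma algebra_homD:
  assumes "h \<in> algebra_hom A B"
  shows "x \<in> carrier A \<Longrightarrow> h x \<in> carrier B"
    and "x \<in> carrier A \<Longrightarrow> y \<in> carrier A \<Longrightarrow> h (x \<otimes>\<^bsub>A\<^esub> y) = h x \<otimes>\<^bsub>B\<^esub> h y"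
    and "x \<in> carrier A \<Longrightarrow> y \<in> carrier A \<Longrightarrow> h (x \<oplus>\<^bsub>A\<^esub> y) = h x \<oplus>\<^bsub>B\<^esub> h y"
    and "h \<one>\<^bsub>A\<^esub> = \<one>\<^bsub>B\<^esub>"
    and "x \<in> carrier A \<Longrightarrow> h (c \<odot>\<^bsub>A\<^esub> x) = c \<odot>\<^bsub>B\<^esub> h x"
  using assms
  by (auto simp: algebra_hom_def ring_hom_closed ring_hom_mult ring_hom_add ring_hom_one)

lemma algebra_hom_comp:
  "g \<in> algebra_hom A B \<Longrightarrow> h \<in> algebra_hom B D \<Longrightarrow> h \<circ> g \<in> algebra_hom A D"
  by (rule algebra_homI) (simp_all add: algebra_homD)

lemma algebra_hom_id: "id \<in> algebra_hom A A"
  by (rule algebra_homI) simp_all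

lemma algebra_hom_zero:
  assumes "unital_algebra A" "unital_algebra B" "h \<in> algebra_hom A B"
  shows "h \<zero>\<^bsub>A\<^esub> = \<zero>\<^bsub>B\<^esub>"
proof -
  interpret A: unital_algebra A by fact
  interpret B: unital_algebra B by fact
  show ?thesis
    using algebra_homD(5) [OF assms(3), of "\<zero>\<^bsub>A\<^esub>" 0] algebra_homD(1) [OF assms(3), of "\<zero>\<^bsub>A\<^esub>"]
    by simp
qed

lemma algebra_hom_finsum:
  assumes "unital_algebra A" "unital_algebra B" "h \<in> algebra_hom A B"
    and "finite X" "\<And>x. x \<in> X \<Longrightarrow> f x \<in> carrier A"
  shows "h (\<Oplus>\<^bsub>A\<^esub>x\<in>X. f x) = (\<Oplus>\<^bsub>B\<^esub>x\<in>X. h (f x))"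
proof -
  interpret A: unital_algebra A by fact
  interpret B: unital_algebra B by fact
  show ?thesis
    using assms(4,5)
  proof (induction X rule: finite_induct)
    case empty
    then show ?case by (simp add: algebra_hom_zero [OF assms(1-3)])
  next
    case (insert x X)
    then have "f \<in> X \<rightarrow> carrier A" "(\<lambda>x. h (f x)) \<in> X \<rightarrow> carrier B"
      using algebra_homD(1) [OF assms(3)] by auto
    with insert show ?case
      by (simp add: algebra_homD [OF assms(3)])
  qed
qed

lemma algebra_isomorphicI:
  assumes g: "g \<in> algebra_hom A B" and h: "h \<in> algebra_hom B A"
    and hg: "\<And>x. x \<in> carrier A \<Longrightarrow> h (g x) = x"
    and gh: "\<And>y. y \<in> carrier B \<Longrightarrow> g (h y) = y"
  shows "A \<cong>\<^sub>a\<^sub>l\<^sub>g B"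
proof -
  have "bij_betw g (carrier A) (carrier B)"
    by (rule bij_betw_byWitness [where f' = h]) (use assms algebra_homD(1) in auto)
  then show ?thesis
    using g unfolding algebra_isomorphic_def algebra_hom_def ring_iso_def by auto
qed

text \<open>
  The homomorphism that extends an assignment \<open>\<phi>\<close> of values to letters: \<open>word_value\<close> is its
  restriction to words, \<open>evaluate\<close> its linear extension.
\<close>

definition word_value :: "('k, 'a) module \<Rightarrow> ('g \<Rightarrow> 'a) \<Rightarrow> 'g list \<Rightarrow> 'a" where
  "word_value A \<phi> w = foldr (\<lambda>g x. \<phi> g \<otimes>\<^bsub>A\<^esub> x) w \<one>\<^bsub>A\<^esub>"

definition evaluate ::
    "('k::field, 'a) module \<Rightarrow> ('g \<Rightarrow> 'a) \<Rightarrow> ('g list \<Rightarrow> 'k) \<Rightarrow> 'a" where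
  "evaluate A \<phi> f = (\<Oplus>\<^bsub>A\<^esub>w\<in>{w. f w \<noteq> 0}. f w \<odot>\<^bsub>A\<^esub> word_value A \<phi> w)"

lemma word_value_simps [simp]:
  "word_value A \<phi> [] = \<one>\<^bsub>A\<^esub>"
  "word_value A \<phi> (g # w) = \<phi> g \<otimes>\<^bsub>A\<^esub> word_value A \<phi> w"
  by (simp_all add: word_value_def)

context unital_algebra
begin

context
  fixes G :: "'g set" and \<phi> :: "'g \<Rightarrow> 'a"
  assumes \<phi>: "\<And>g. g \<in> G \<Longrightarrow> \<phi> g \<in> carrier A"
begin

lemma word_value_closed: "w \<in> lists G \<Longrightarrow> word_value A \<phi> w \<in> carrier A"
  by (induction w) (auto simp: \<phi>)

lemma word_value_append:
  "u \<in> lists G \<Longrightarrow> v \<in> lists G \<Longrightarrow>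
    word_value A \<phi> (u @ v) = word_value A \<phi> u \<otimes> word_value A \<phi> v"
  by (induction u) (auto simp: \<phi> m_assoc word_value_closed)

text \<open>
  Elements with different supports can be compared once the sum is taken over a common finite set.
\<close>

lemma evaluate_superset:
  assumes "finite S" "S \<subseteq> lists G" "{w. f w \<noteq> 0} \<subseteq> S"
  shows "evaluate A \<phi> f = (\<Oplus>w\<in>S. f w \<odot> word_value A \<phi> w)"
proof -
  have "word_value A \<phi> w \<in> carrier A" if "w \<in> S" for w
    using that assms(2) word_value_closed by blast
  then show ?thesis
    unfolding evaluate_def using assms
    by (intro add.finprod_mono_neutral_cong_left) auto
qed

lemma evaluate_closed: "f \<in> carrier (word_algebra (lists G)) \<Longrightarrow> evaluate A \<phi> f \<in> carrier A"
  unfolding evaluate_def mem_carrier_word_algebra using word_value_closed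
  by (intro finsum_closed) auto

lemma evaluate_add:
  assumes "f \<in> carrier (word_algebra (lists G))" "g \<in> carrier (word_algebra (lists G))"
  shows "evaluate A \<phi> (f + g) = evaluate A \<phi> f \<oplus> evaluate A \<phi> g"
proof -
  let ?S = "{w. f w \<noteq> 0} \<union> {w. g w \<noteq> 0}"
  have S: "finite ?S" "?S \<subseteq> lists G" "{w. (f + g) w \<noteq> 0} \<subseteq> ?S"
    using assms by (auto simp: mem_carrier_word_algebra plus_fun_apply)
  then have closed: "word_value A \<phi> w \<in> carrier A" if "w \<in> ?S" for w
    using word_value_closed that by blast
  have "evaluate A \<phi> (f + g) = (\<Oplus>w\<in>?S. (f + g) w \<odot> word_value A \<phi> w)"
    by (rule evaluate_superset [OF S])
  also have "\<dots> = (\<Oplus>w\<in>?S. f w \<odot> word_value A \<phi> w \<oplus> g w \<odot> word_value A \<phi> w)"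
    using closed by (intro finsum_cong') (auto simp: smult_add_left plus_fun_apply)
  also have "\<dots> = (\<Oplus>w\<in>?S. f w \<odot> word_value A \<phi> w) \<oplus> (\<Oplus>w\<in>?S. g w \<odot> word_value A \<phi> w)"
    using closed by (intro finsum_addf) auto
  also have "\<dots> = evaluate A \<phi> f \<oplus> evaluate A \<phi> g"
    using S by (subst (1 2) evaluate_superset [of ?S]) auto
  finally show ?thesis .
qed

lemma evaluate_zero [simp]: "evaluate A \<phi> 0 = \<zero>"
  by (simp add: evaluate_def zero_fun_apply)

lemma evaluate_scale_word:
  assumes "w \<in> lists G"
  shows "evaluate A \<phi> (scale c (word w)) = c \<odot> word_value A \<phi> w"
proof -
  have "evaluate A \<phi> (scale c (word w)) = (\<Oplus>x\<in>{w}. scale c (word w) x \<odot> word_value A \<phi> x)"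
    using assms by (intro evaluate_superset) (auto simp: scale_def word_def)
  also have "\<dots> = c \<odot> word_value A \<phi> w"
    using word_value_closed [OF assms] by (simp add: scale_def word_def)
  finally show ?thesis .
qed

lemma evaluate_word: "w \<in> lists G \<Longrightarrow> evaluate A \<phi> (word w) = word_value A \<phi> w"
  using evaluate_scale_word [of w 1] word_value_closed [of w] by simp

lemma evaluate_scale:
  assumes "f \<in> carrier (word_algebra (lists G))"
  shows "evaluate A \<phi> (scale c f) = c \<odot> evaluate A \<phi> f"
  using assms
proof (induction rule: word_algebra_induct)
  case zero
  show ?case by (simp only: scale_zero_right evaluate_zero smult_zero_right)
next
  case (add d w f)
  then show ?case
    using word_value_closed [of w]
    by (simp add: scale_add_right scale_scale evaluate_add evaluate_scale_word evaluate_closed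
        word_algebra_scale smult_smult smult_add_right)
qed

lemma evaluate_diff:
  assumes "f \<in> carrier (word_algebra (lists G))" "g \<in> carrier (word_algebra (lists G))"
  shows "evaluate A \<phi> (f - g) = evaluate A \<phi> f \<ominus> evaluate A \<phi> g"
proof -
  have "evaluate A \<phi> ((f - g) + g) = evaluate A \<phi> (f - g) \<oplus> evaluate A \<phi> g"
    using assms by (intro evaluate_add word_algebra_diff)
  then show ?thesis
    using assms evaluate_closed word_algebra_diff
    by (simp add: minus_eq a_assoc r_neg evaluate_closed word_algebra_diff)
qed

lemma evaluate_sum:
  assumes "finite X" "\<And>x. x \<in> X \<Longrightarrow> f x \<in> carrier (word_algebra (lists G))"
  shows "evaluate A \<phi> (\<Sum>x\<in>X. f x) = (\<Oplus>x\<in>X. evaluate A \<phi> (f x))"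
  using assms
  by (induction X rule: finite_induct)
    (auto simp: evaluate_add word_algebra_sum evaluate_closed Pi_def)

text \<open>
  Both sides are bilinear, so this reduces to \<open>word_value_append\<close> by linearity in each argument.
\<close>

lemma evaluate_convolution:
  assumes "f \<in> carrier (word_algebra (lists G))" "g \<in> carrier (word_algebra (lists G))"
  shows "evaluate A \<phi> (convolution f g) = evaluate A \<phi> f \<otimes> evaluate A \<phi> g"
  using assms(1)
proof (induction rule: word_algebra_induct)
  case zero
  show ?case
    using assms(2) by (simp only: convolution_zero_left evaluate_zero evaluate_closed l_null)
next
  case (add c u f)
  have "evaluate A \<phi> (convolution (word u) g) = word_value A \<phi> u \<otimes> evaluate A \<phi> g"
    using assms(2)
  proof (induction rule: word_algebra_induct)
    case zero
    show ?case
      using add(1) by (simp only: convolution_zero_right evaluate_zero word_value_closed r_null)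
  next
    case (add d v g)
    then show ?case
      using \<open>u \<in> lists G\<close> word_value_closed [of u] word_value_closed [of v]
      by (simp add: convolution_add_right convolution_scale_right convolution_word evaluate_add
          evaluate_scale_word evaluate_closed word_algebra_scale word_algebra_convolution
          word_value_append smult_mult_right r_distr)
  qed
  then show ?case
    using add assms(2) word_value_closed [of u]
    by (simp add: convolution_add_left convolution_scale_left evaluate_add evaluate_scale
        evaluate_word evaluate_closed word_algebra_scale word_algebra_convolution
        smult_mult_left l_distr)
qed

end

end


section \<open>Presented algebras\<close>

text \<open>
  The algebra with generators \<open>G\<close> and relations \<open>R\<close>, as a quotient of either the free unital
  algebra (for the free product) or the free non-unital algebra (for the Leavitt path algebra).  In
  the second case an identity has to be provided: \<open>u\<close> is required to act as one on the generators
  modulo the relations.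
\<close>

locale algebra_presentation =
  fixes G :: "'g set" and W :: "'g list set" and R :: "('g list \<Rightarrow> 'k::field) set"
    and u :: "'g list \<Rightarrow> 'k"
  assumes words: "W = lists G \<and> u = word [] \<or> W = lists G - {[]}"
    and rels: "R \<subseteq> carrier (word_algebra W)"
    and unit: "u \<in> carrier (word_algebra W)"
    and unit_left: "g \<in> G \<Longrightarrow>
      convolution u (word [g]) - word [g] \<in> algebra_ideal (word_algebra W) R"
    and unit_right: "g \<in> G \<Longrightarrow>
      convolution (word [g]) u - word [g] \<in> algebra_ideal (word_algebra W) R"
begin

abbreviation F :: "('k, 'g list \<Rightarrow> 'k) module" where "F \<equiv> word_algebra W"

definition I :: "('g list \<Rightarrow> 'k) set" where "I = algebra_ideal F R"

definition cls :: "('g list \<Rightarrow> 'k) \<Rightarrow> ('g list \<Rightarrow> 'k) set" where "cls f = I +>\<^bsub>F\<^esub> f"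

definition P :: "('k, ('g list \<Rightarrow> 'k) set) module" where
  "P = (quotient_algebra F I)\<lparr>one := cls u\<rparr>"

lemma append_closed: "v \<in> W \<Longrightarrow> w \<in> W \<Longrightarrow> v @ w \<in> W"
  using words by auto

lemma letters: "g \<in> G \<Longrightarrow> [g] \<in> W"
  using words by auto

lemma W_subset: "W \<subseteq> lists G"
  using words by auto

lemmas F_closed = word_algebra_convolution [OF append_closed] word_algebra_add word_algebra_scale
  word_algebra_diff

lemma carrier_F: "f \<in> carrier F \<Longrightarrow> f \<in> carrier (word_algebra (lists G))"
  using carrier_word_algebra_mono [OF W_subset] .

lemma I_zero: "0 \<in> I"
  and I_add: "x \<in> I \<Longrightarrow> y \<in> I \<Longrightarrow> x + y \<in> I"
  and I_scale: "x \<in> I \<Longrightarrow> scale c x \<in> I"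
  and I_left: "x \<in> I \<Longrightarrow> f \<in> carrier F \<Longrightarrow> convolution f x \<in> I"
  and I_right: "x \<in> I \<Longrightarrow> f \<in> carrier F \<Longrightarrow> convolution x f \<in> I"
  and I_rel: "x \<in> R \<Longrightarrow> x \<in> I"
  using algebra_ideal.intros [where A = F and S = R] by (simp_all add: I_def)

lemma I_uminus: "x \<in> I \<Longrightarrow> - x \<in> I"
  using I_scale [of x "- 1"] by (simp add: scale_minus_one)

lemma I_diff: "x \<in> I \<Longrightarrow> y \<in> I \<Longrightarrow> x - y \<in> I"
  using I_add [of x "- y"] I_uminus [of y] by simp

lemma I_subset: "x \<in> I \<Longrightarrow> x \<in> carrier F"
  unfolding I_def
  by (induction rule: algebra_ideal.induct) (use rels F_closed in auto)

lemma mem_cls: "x \<in> cls f \<longleftrightarrow> x - f \<in> I"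
proof
  assume "x - f \<in> I"
  then have "\<exists>h\<in>I. x = h + f" by (intro bexI [of _ "x - f"]) auto
  then show "x \<in> cls f" by (auto simp: cls_def a_r_coset_def r_coset_def)
qed (auto simp: cls_def a_r_coset_def r_coset_def)

lemma cls_self: "f \<in> cls f"
  by (simp add: mem_cls I_zero)

lemma cls_eqI:
  assumes "f - g \<in> I"
  shows "cls f = cls g"
proof (rule Set.set_eqI)
  fix x
  show "x \<in> cls f \<longleftrightarrow> x \<in> cls g"
    unfolding mem_cls using I_add [OF _ assms, of "x - f"] I_diff [OF _ assms, of "x - g"]
    by auto
qed

lemma carrier_P: "carrier P = cls ` carrier F"
  by (auto simp: P_def quotient_algebra_def ring.defs FactRing_def A_RCOSETS_def RCOSETS_def
      cls_def a_r_coset_def)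

lemma zero_P: "\<zero>\<^bsub>P\<^esub> = cls 0"
  by (auto simp: P_def quotient_algebra_def ring.defs FactRing_def mem_cls)

lemma one_P: "\<one>\<^bsub>P\<^esub> = cls u"
  by (simp add: P_def)

lemma add_P: "cls f \<oplus>\<^bsub>P\<^esub> cls g = cls (f + g)"
proof -
  have "cls f \<oplus>\<^bsub>P\<^esub> cls g = {x + y | x y. x \<in> cls f \<and> y \<in> cls g}"
    by (auto simp: P_def quotient_algebra_def ring.defs FactRing_def set_add_def set_mult_def)
  also have "\<dots> = cls (f + g)"
  proof (intro Set.set_eqI iffI)
    fix z
    assume "z \<in> {x + y | x y. x \<in> cls f \<and> y \<in> cls g}"
    then obtain x y where "z = x + y" "x - f \<in> I" "y - g \<in> I"
      by (auto simp: mem_cls)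
    then show "z \<in> cls (f + g)"
      using I_add [of "x - f" "y - g"] by (simp add: mem_cls algebra_simps)
  next
    fix z
    assume "z \<in> cls (f + g)"
    then have "z - g \<in> cls f" by (simp add: mem_cls algebra_simps)
    with cls_self [of g] show "z \<in> {x + y | x y. x \<in> cls f \<and> y \<in> cls g}"
      by (intro CollectI exI [of _ "z - g"] exI [of _ g]) simp
  qed
  finally show ?thesis .
qed

lemma mult_P:
  assumes f: "f \<in> carrier F" and g: "g \<in> carrier F"
  shows "cls f \<otimes>\<^bsub>P\<^esub> cls g = cls (convolution f g)"
proof -
  have eq: "cls (convolution x y) = cls (convolution f g)" if "x \<in> cls f" "y \<in> cls g" for x y
  proof (rule cls_eqI)
    from that have x: "x - f \<in> I" and y: "y - g \<in> I"
      by (simp_all add: mem_cls)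
    then have "y \<in> carrier F"
      using word_algebra_add [OF I_subset [OF y] g] by simp
    then have "convolution (x - f) y + convolution f (y - g) \<in> I"
      using x y f by (intro I_add I_left I_right)
    then show "convolution x y - convolution f g \<in> I"
      by (simp add: convolution_diff_left convolution_diff_right)
  qed
  have "cls f \<otimes>\<^bsub>P\<^esub> cls g = (\<Union>x\<in>cls f. \<Union>y\<in>cls g. cls (convolution x y))"
    by (simp add: P_def quotient_algebra_def ring.defs FactRing_def rcoset_mult_def cls_def)
  also have "\<dots> = (\<Union>x\<in>cls f. \<Union>y\<in>cls g. cls (convolution f g))"
    using eq by (intro SUP_cong) auto
  also have "\<dots> = cls (convolution f g)"
    using cls_self by blast
  finally show ?thesis .
qed

lemma smult_P: "c \<odot>\<^bsub>P\<^esub> cls f = cls (scale c f)"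
proof -
  have "cls (scale c x) = cls (scale c f)" if "x \<in> cls f" for x
    using that I_scale [of "x - f" c] by (intro cls_eqI) (simp add: mem_cls scale_diff_right)
  then have "(\<Union>x\<in>cls f. cls (scale c x)) = (\<Union>x\<in>cls f. cls (scale c f))"
    by (intro SUP_cong) auto
  also have "\<dots> = cls (scale c f)"
    using cls_self by blast
  finally show ?thesis
    by (simp add: P_def quotient_algebra_def ring.defs module.defs cls_def)
qed

text \<open>
  An element that fixes every generator fixes every word, because left multiplication only meets the
  first letter and right multiplication only the last one.
\<close>

lemma unit_mod:
  assumes "f \<in> carrier F"
  shows "convolution u f - f \<in> I" "convolution f u - f \<in> I"
proof -
  have *: "convolution u (word w) - word w \<in> I \<and> convolution (word w) u - word w \<in> I"
    if "w \<in> W" for w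
  proof (cases "w = []")
    case True
    with words that have "u = word []" by auto
    then show ?thesis by (simp add: I_zero)
  next
    case False
    have left: "convolution u (word (g # w)) - word (g # w) \<in> I" if "g # w \<in> lists G" for g w
    proof (cases "w = []")
      case True
      with that unit_left show ?thesis by (simp add: I_def)
    next
      case False
      then have "w \<in> W" using that words by auto
      then have "convolution (convolution u (word [g]) - word [g]) (word w) \<in> I"
        using unit_left [of g] that by (intro I_right) (auto simp: I_def)
      then show ?thesis
        by (simp add: convolution_diff_left convolution_word convolution_assoc)
    qed
    have right: "convolution (word (w @ [g])) u - word (w @ [g]) \<in> I" if "w @ [g] \<in> lists G" for g w
    proof (cases "w = []")
      case True
      with that unit_right show ?thesis by (simp add: I_def)
    next
      case False
      then have "w \<in> W" using that words by auto
      then have "convolution (word w) (convolution (word [g]) u - word [g]) \<in> I"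
        using unit_right [of g] that by (intro I_left) (auto simp: I_def)
      then show ?thesis
        by (simp add: convolution_diff_right convolution_word flip: convolution_assoc)
    qed
    have "w \<in> lists G" using that W_subset by auto
    with False left right show ?thesis
      by (metis neq_Nil_conv rev_exhaust)
  qed
  have "convolution u f - f \<in> I \<and> convolution f u - f \<in> I"
    using assms
  proof (induction rule: word_algebra_induct)
    case zero
    then show ?case by (simp add: I_zero)
  next
    case (add c w f)
    then have "scale c (convolution u (word w) - word w) + (convolution u f - f) \<in> I"
      "scale c (convolution (word w) u - word w) + (convolution f u - f) \<in> I"
      using * by (auto intro!: I_add I_scale)
    then show ?case
      by (simp add: convolution_add_left convolution_add_right convolution_scale_left
          convolution_scale_right scale_diff_right algebra_simps)
  qed
  then show "convolution u f - f \<in> I" "convolution f u - f \<in> I" by auto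
qed

lemma P_unital_algebra: "unital_algebra P"
proof -
  note P = zero_P one_P add_P mult_P smult_P F_closed
  have unit_cls: "cls (convolution u f) = cls f" "cls (convolution f u) = cls f"
    if "f \<in> carrier F" for f
    using unit_mod [OF that] by (simp_all add: cls_eqI)
  have "abelian_group P"
  proof (rule abelian_groupI, unfold carrier_P)
    show "\<exists>y\<in>cls ` carrier F. y \<oplus>\<^bsub>P\<^esub> x = \<zero>\<^bsub>P\<^esub>" if "x \<in> cls ` carrier F" for x
    proof -
      from that obtain f where "x = cls f" "f \<in> carrier F" by auto
      then show ?thesis
        by (intro bexI [of _ "cls (scale (- 1) f)"]) (auto simp: P scale_minus_one word_algebra_uminus)
    qed
  qed (auto simp: P algebra_simps)
  moreover have "monoid P"
    by (rule monoidI)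
      (auto simp: P carrier_P unit convolution_assoc unit_cls)
  ultimately have "ring P"
    by (intro ringI)
      (auto simp: P carrier_P convolution_add_left convolution_add_right abelian_group_def
        abelian_monoid_def monoid.m_assoc)
  then show ?thesis
    by (intro unital_algebra.intro unital_algebra_axioms.intro)
      (auto simp: P carrier_P scale_scale scale_add_left scale_add_right
        convolution_scale_left convolution_scale_right)
qed

text \<open>
  Evaluation vanishes on the ideal because it does so on the relations, and therefore descends to
  the quotient.
\<close>

lemma universal_hom:
  assumes "unital_algebra B"
    and \<phi>: "\<And>g. g \<in> G \<Longrightarrow> \<phi> g \<in> carrier B"
    and R: "\<And>r. r \<in> R \<Longrightarrow> evaluate B \<phi> r = \<zero>\<^bsub>B\<^esub>"
    and u: "evaluate B \<phi> u = \<one>\<^bsub>B\<^esub>"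
  obtains h where "h \<in> algebra_hom P B" "\<And>g. g \<in> G \<Longrightarrow> h (cls (word [g])) = \<phi> g"
proof -
  interpret B: unital_algebra B by fact
  note closed = B.evaluate_closed [OF \<phi> carrier_F]
  have kills: "evaluate B \<phi> x = \<zero>\<^bsub>B\<^esub>" if "x \<in> I" for x
    using that unfolding I_def
  proof (induction rule: algebra_ideal.induct)
    case (generator x)
    then show ?case by (rule R)
  next
    case zero
    then show ?case by (simp add: B.evaluate_zero [of G, OF \<phi>])
  next
    case (add x y)
    then show ?case
      using I_subset [of x] I_subset [of y] carrier_F
      by (simp add: I_def B.evaluate_add [of G, OF \<phi>])
  next
    case (smult x c)
    then show ?case
      using I_subset [of x] carrier_F by (simp add: I_def B.evaluate_scale [of G, OF \<phi>])
  next
    case (left x a)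
    then show ?case
      using I_subset [of x] carrier_F closed
      by (simp add: I_def B.evaluate_convolution [of G, OF \<phi>])
  next
    case (right x a)
    then show ?case
      using I_subset [of x] carrier_F closed
      by (simp add: I_def B.evaluate_convolution [of G, OF \<phi>])
  qed
  \<comment> \<open>Any representative of the class may be evaluated.\<close>
  define h where "h Z = evaluate B \<phi> (SOME z. z \<in> Z)" for Z
  have h: "h (cls f) = evaluate B \<phi> f" if f: "f \<in> carrier F" for f
  proof -
    define z where "z = (SOME z. z \<in> cls f)"
    have "z \<in> cls f" unfolding z_def by (rule someI [of "\<lambda>z. z \<in> cls f"]) (rule cls_self)
    then have z: "z - f \<in> I" by (simp add: mem_cls)
    have "evaluate B \<phi> ((z - f) + f) = evaluate B \<phi> (z - f) \<oplus>\<^bsub>B\<^esub> evaluate B \<phi> f"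
      by (rule B.evaluate_add [OF \<phi>]) (use carrier_F I_subset z f in auto)
    then show ?thesis
      using kills [OF z] closed [OF _ f] by (simp add: h_def z_def)
  qed
  have "h \<in> algebra_hom P B"
    by (rule algebra_homI)
      (auto simp: carrier_P add_P mult_P smult_P one_P h F_closed unit u closed carrier_F
        B.evaluate_add [of G, OF \<phi>] B.evaluate_convolution [of G, OF \<phi>]
        B.evaluate_scale [of G, OF \<phi>])
  moreover have "h (cls (word [g])) = \<phi> g" if "g \<in> G" for g
    using that \<phi> [of g] letters by (simp add: h B.evaluate_word [of G, OF \<phi>])
  ultimately show ?thesis using that by blast
qed

text \<open>
  The classes of the generators generate the algebra as a unital algebra.
\<close>

lemma hom_unique:
  assumes B: "unital_algebra B"
    and h: "h \<in> algebra_hom P B" and k: "k \<in> algebra_hom P B"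
    and agree: "\<And>g. g \<in> G \<Longrightarrow> h (cls (word [g])) = k (cls (word [g]))"
    and x: "x \<in> carrier P"
  shows "h x = k x"
proof -
  have words: "h (cls (word w)) = k (cls (word w))" if "w \<in> W" for w
    using that
  proof (induction w)
    case Nil
    then have "cls (word []) = \<one>\<^bsub>P\<^esub>"
      using words by (auto simp: one_P)
    then show ?case
      using algebra_homD(4) [OF h] algebra_homD(4) [OF k] by simp
  next
    case (Cons g w)
    then have g: "g \<in> G" using W_subset by auto
    show ?case
    proof (cases "w = []")
      case True
      then show ?thesis using agree g by simp
    next
      case False
      with Cons words have w: "w \<in> W" by auto
      have "cls (word (g # w)) = cls (word [g]) \<otimes>\<^bsub>P\<^esub> cls (word w)"
        using w g letters by (simp add: mult_P convolution_word)
      then show ?thesis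
        using algebra_homD(2) [OF h] algebra_homD(2) [OF k] agree g w Cons.IH letters
        by (simp add: carrier_P)
    qed
  qed
  from x obtain f where f: "f \<in> carrier F" and xf: "x = cls f"
    by (auto simp: carrier_P)
  from f have "h (cls f) = k (cls f)"
  proof (induction rule: word_algebra_induct)
    case zero
    then show ?case
      using algebra_hom_zero [OF P_unital_algebra B h] algebra_hom_zero [OF P_unital_algebra B k]
      by (simp add: zero_P)
  next
    case (add c w f)
    have "cls (scale c (word w) + f) = c \<odot>\<^bsub>P\<^esub> cls (word w) \<oplus>\<^bsub>P\<^esub> cls f"
      by (simp add: add_P smult_P)
    moreover have "cls (word w) \<in> carrier P" "cls f \<in> carrier P" "c \<odot>\<^bsub>P\<^esub> cls (word w) \<in> carrier P"
      using add by (auto simp: carrier_P smult_P word_algebra_scale)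
    ultimately show ?case
      using words [of w] add algebra_homD [OF h] algebra_homD [OF k] by simp
  qed
  with xf show ?thesis by simp
qed

lemma relation_holds: "f - g \<in> R \<Longrightarrow> cls f = cls g"
  by (intro cls_eqI I_rel)

lemma cls_sum: "finite X \<Longrightarrow> (\<And>x. x \<in> X \<Longrightarrow> f x \<in> carrier F) \<Longrightarrow>
    (\<Oplus>\<^bsub>P\<^esub>x\<in>X. cls (f x)) = cls (\<Sum>x\<in>X. f x)"
proof (induction X rule: finite_induct)
  interpret unital_algebra P by (rule P_unital_algebra)
  {
    case empty
    then show ?case by (simp add: zero_P)
  next
    case (insert x X)
    then have "(\<lambda>x. cls (f x)) \<in> X \<rightarrow> carrier P" "cls (f x) \<in> carrier P"
      by (auto simp: carrier_P)
    with insert show ?case by (simp add: add_P)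
  }
qed

end

section \<open>Free products\<close>

text \<open>
  The canonical map from the factor \<open>A i\<close> to the free product.
\<close>

definition free_product_inj ::
    "'i set \<Rightarrow> ('i \<Rightarrow> ('k::field, 'a) module) \<Rightarrow> 'i \<Rightarrow> 'a \<Rightarrow> (('i \<times> 'a) list \<Rightarrow> 'k) set" where
  "free_product_inj I A i a =
     (let F = word_algebra (lists (SIGMA i:I. carrier (A i)))
      in algebra_ideal F (free_product_rels I A) +>\<^bsub>F\<^esub> word [(i, a)])"

text \<open>
  The factors have to be algebras for the relations of the free product to lie in the algebra of
  words in elements of their carriers.
\<close>

locale unital_algebra_family =
  fixes I :: "'i set" and A :: "'i \<Rightarrow> ('k::field, 'a) module"
  assumes unital: "i \<in> I \<Longrightarrow> unital_algebra (A i)"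
begin

sublocale Q: algebra_presentation "SIGMA i:I. carrier (A i)" "lists (SIGMA i:I. carrier (A i))"
  "free_product_rels I A" "word []"
proof
  let ?F = "word_algebra (lists (SIGMA i:I. carrier (A i))) :: ('k, _) module"
  show "free_product_rels I A \<subseteq> carrier ?F"
  proof
    fix r
    assume "r \<in> free_product_rels I A"
    then show "r \<in> carrier ?F"
    proof cases
      case (add i a b)
      interpret unital_algebra "A i" using unital add by blast
      from add show ?thesis
        by (auto intro!: word_algebra_diff word_algebra_add)
    next
      case (smult i a c)
      interpret unital_algebra "A i" using unital smult by blast
      from smult show ?thesis
        by (auto intro!: word_algebra_diff word_algebra_scale)
    next
      case (mult i a b)
      interpret unital_algebra "A i" using unital mult by blast
      from mult show ?thesis
        by (auto intro!: word_algebra_diff)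
    next
      case (one i)
      interpret unital_algebra "A i" using unital one by blast
      from one show ?thesis
        by (auto intro!: word_algebra_diff)
    qed
  qed
  \<comment> \<open>The empty word is an identity already before passing to the quotient.\<close>
qed (auto intro: algebra_ideal.zero [where A = "word_algebra W" for W, simplified])

lemma free_product_eq: "free_product I A = Q.P"
  by (simp add: free_product_def Q.P_def Q.I_def Q.cls_def quotient_algebra_def ring.defs
      FactRing_def Let_def)

lemma free_product_inj_eq: "free_product_inj I A i a = Q.cls (word [(i, a)])"
  by (simp add: free_product_inj_def Q.I_def Q.cls_def Let_def)

lemma unital_algebra_free_product: "unital_algebra (free_product I A)"
  unfolding free_product_eq by (rule Q.P_unital_algebra)

text \<open>
  Each of the four kinds of relations makes the map compatible with one operation.
\<close>

lemma free_product_inj_hom: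
  assumes i: "i \<in> I"
  shows "free_product_inj I A i \<in> algebra_hom (A i) (free_product I A)"
proof -
  interpret A: unital_algebra "A i" using unital i .
  have letter: "word [(i, a)] \<in> carrier Q.F" if "a \<in> carrier (A i)" for a
    using that i by simp
  have "Q.cls (word [(i, a \<otimes>\<^bsub>A i\<^esub> b)]) = Q.cls (word [(i, a)]) \<otimes>\<^bsub>Q.P\<^esub> Q.cls (word [(i, b)])"
    if "a \<in> carrier (A i)" "b \<in> carrier (A i)" for a b
    using that i
    by (simp add: Q.mult_P letter convolution_word
        Q.relation_holds [OF free_product_rels.mult])
  moreover have "Q.cls (word [(i, a \<oplus>\<^bsub>A i\<^esub> b)]) = Q.cls (word [(i, a)]) \<oplus>\<^bsub>Q.P\<^esub> Q.cls (word [(i, b)])"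
    if "a \<in> carrier (A i)" "b \<in> carrier (A i)" for a b
    using that i by (simp add: Q.add_P Q.relation_holds [OF free_product_rels.add])
  moreover have "Q.cls (word [(i, c \<odot>\<^bsub>A i\<^esub> a)]) = c \<odot>\<^bsub>Q.P\<^esub> Q.cls (word [(i, a)])"
    if "a \<in> carrier (A i)" for a c
    using that i by (simp add: Q.smult_P Q.relation_holds [OF free_product_rels.smult])
  moreover have "Q.cls (word [(i, \<one>\<^bsub>A i\<^esub>)]) = \<one>\<^bsub>Q.P\<^esub>"
    using i by (simp add: Q.one_P Q.relation_holds [OF free_product_rels.one])
  ultimately show ?thesis
    unfolding free_product_eq free_product_inj_eq
    by (intro algebra_homI) (auto simp: free_product_inj_eq Q.carrier_P intro!: imageI letter)
qed

lemma free_product_hom: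
  assumes "unital_algebra B" and h: "\<And>i. i \<in> I \<Longrightarrow> h i \<in> algebra_hom (A i) B"
  obtains k where "k \<in> algebra_hom (free_product I A) B"
    "\<And>i a. i \<in> I \<Longrightarrow> a \<in> carrier (A i) \<Longrightarrow> k (free_product_inj I A i a) = h i a"
proof -
  interpret B: unital_algebra B by fact
  let ?G = "SIGMA i:I. carrier (A i)"
  define \<phi> where "\<phi> = (\<lambda>(i, a). h i a)"
  have \<phi>_pair: "\<phi> (i, a) = h i a" for i a
    by (simp add: \<phi>_def)
  have \<phi>: "\<phi> g \<in> carrier B" if "g \<in> ?G" for g
    using that algebra_homD(1) [OF h] by (auto simp: \<phi>_def)
  note ev = B.evaluate_diff [of ?G, OF \<phi>] B.evaluate_add [of ?G, OF \<phi>]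
    B.evaluate_scale [of ?G, OF \<phi>] B.evaluate_word [of ?G, OF \<phi>] word_algebra_add
    word_algebra_scale B.minus_eq B.r_neg
  have "evaluate B \<phi> r = \<zero>\<^bsub>B\<^esub>" if "r \<in> free_product_rels I A" for r
    using that
  proof cases
    case (add i a b)
    interpret unital_algebra "A i" using unital add by blast
    from add algebra_homD [OF h [of i]] show ?thesis
      by (simp add: ev \<phi>_pair)
  next
    case (smult i a c)
    interpret unital_algebra "A i" using unital smult by blast
    from smult algebra_homD [OF h [of i]] show ?thesis
      by (simp add: ev \<phi>_pair)
  next
    case (mult i a b)
    interpret unital_algebra "A i" using unital mult by blast
    from mult algebra_homD [OF h [of i]] show ?thesis
      by (simp add: ev \<phi>_pair)
  next
    case (one i)
    interpret unital_algebra "A i" using unital one by blast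
    from one algebra_homD [OF h [of i]] show ?thesis
      by (simp add: ev \<phi>_pair)
  qed
  moreover have "evaluate B \<phi> (word []) = \<one>\<^bsub>B\<^esub>"
    by (simp add: ev)
  ultimately obtain k where "k \<in> algebra_hom Q.P B" "\<And>g. g \<in> ?G \<Longrightarrow> k (Q.cls (word [g])) = \<phi> g"
    using Q.universal_hom [OF assms(1), of \<phi>] \<phi> by blast
  then show ?thesis
    using that [of k] by (simp add: free_product_eq free_product_inj_eq \<phi>_pair)
qed

lemma free_product_hom_unique:
  assumes "unital_algebra B"
    and "h \<in> algebra_hom (free_product I A) B" "k \<in> algebra_hom (free_product I A) B"
    and "\<And>i a. i \<in> I \<Longrightarrow> a \<in> carrier (A i) \<Longrightarrow>
      h (free_product_inj I A i a) = k (free_product_inj I A i a)"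
    and "x \<in> carrier (free_product I A)"
  shows "h x = k x"
  using assms unfolding free_product_eq free_product_inj_eq
  by (intro Q.hom_unique [of B h k x]) auto

end


section \<open>Leavitt path algebras with one vertex\<close>

text \<open>
  The relations (SCK1) and (SCK2) for a single block \<open>X\<close>, in a unital algebra where the vertex is
  represented by the identity.  With \<open>a\<close> as a row and \<open>b\<close> as a column, \<open>b a\<close> is the identity matrix
  of size \<open>X\<close>, and \<open>a b = 1\<close> when \<open>X\<close> is finite.
\<close>

definition leavitt_family ::
    "('k, 'a) module \<Rightarrow> 'e set \<Rightarrow> ('e \<Rightarrow> 'a) \<Rightarrow> ('e \<Rightarrow> 'a) \<Rightarrow> bool" where
  "leavitt_family B X a b \<longleftrightarrow>
     (\<forall>e\<in>X. a e \<in> carrier B \<and> b e \<in> carrier B) \<and>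
     (\<forall>e\<in>X. \<forall>e'\<in>X. b e \<otimes>\<^bsub>B\<^esub> a e' = (if e = e' then \<one>\<^bsub>B\<^esub> else \<zero>\<^bsub>B\<^esub>)) \<and>
     (finite X \<longrightarrow> (\<Oplus>\<^bsub>B\<^esub>e\<in>X. a e \<otimes>\<^bsub>B\<^esub> b e) = \<one>\<^bsub>B\<^esub>)"

lemma leavitt_family_hom:
  assumes "unital_algebra A" "unital_algebra B" "h \<in> algebra_hom A B"
    and family: "leavitt_family A X a b"
    and "\<And>e. e \<in> X \<Longrightarrow> a' e = h (a e)" "\<And>e. e \<in> X \<Longrightarrow> b' e = h (b e)"
  shows "leavitt_family B X a' b'"
proof -
  interpret A: unital_algebra A by fact
  interpret B: unital_algebra B by fact
  note h = algebra_homD [OF assms(3)]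
  have ab: "a e \<in> carrier A" "b e \<in> carrier A" if "e \<in> X" for e
    using family that by (auto simp: leavitt_family_def)
  have "(\<Oplus>\<^bsub>B\<^esub>e\<in>X. a' e \<otimes>\<^bsub>B\<^esub> b' e) = \<one>\<^bsub>B\<^esub>" if "finite X"
  proof -
    have "(\<Oplus>\<^bsub>B\<^esub>e\<in>X. a' e \<otimes>\<^bsub>B\<^esub> b' e) = (\<Oplus>\<^bsub>B\<^esub>e\<in>X. h (a e \<otimes>\<^bsub>A\<^esub> b e))"
      using assms(5,6) ab h by (intro B.finsum_cong') auto
    also have "\<dots> = h (\<Oplus>\<^bsub>A\<^esub>e\<in>X. a e \<otimes>\<^bsub>A\<^esub> b e)"
      using algebra_hom_finsum [OF assms(1-3) that, of "\<lambda>e. a e \<otimes>\<^bsub>A\<^esub> b e"] ab by simp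
    also have "\<dots> = \<one>\<^bsub>B\<^esub>"
      using family that h(4) by (simp add: leavitt_family_def)
    finally show ?thesis .
  qed
  moreover have "b' e \<otimes>\<^bsub>B\<^esub> a' e' = (if e = e' then \<one>\<^bsub>B\<^esub> else \<zero>\<^bsub>B\<^esub>)" if "e \<in> X" "e' \<in> X" for e e'
  proof -
    have "b' e \<otimes>\<^bsub>B\<^esub> a' e' = h (b e \<otimes>\<^bsub>A\<^esub> a e')"
      using that assms(5,6) ab h by simp
    also have "\<dots> = (if e = e' then \<one>\<^bsub>B\<^esub> else \<zero>\<^bsub>B\<^esub>)"
      using family that h(4) algebra_hom_zero [OF assms(1-3)] by (simp add: leavitt_family_def)
    finally show ?thesis .
  qed
  ultimately show ?thesis
    using assms(5,6) ab h by (simp add: leavitt_family_def)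
qed

definition lpa_class ::
    "('v, 'e) pre_digraph \<Rightarrow> ('v \<Rightarrow> 'e set set) \<Rightarrow> ('v, 'e) lpa_gen \<Rightarrow>
     (('v, 'e) lpa_gen list \<Rightarrow> 'k::field) set" where
  "lpa_class E C g =
     (let F = word_algebra (lists (lpa_gens E) - {[]})
      in algebra_ideal F (lpa_rels E C) +>\<^bsub>F\<^esub> word [g])"

text \<open>
  A fixed name for the vertex.  The locale covers the given graph as well as the roses that
  define the Leavitt algebras, so that each lemma below is available for both.
\<close>

locale one_vertex_graph = separated_graph E C
  for E :: "('v, 'e) pre_digraph" and C :: "'v \<Rightarrow> 'e set set" +
  fixes v :: 'v
  assumes one_vertex: "verts E = {v}"
begin

lemma tail_eq: "e \<in> arcs E \<Longrightarrow> tail E e = v"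
  and head_eq: "e \<in> arcs E \<Longrightarrow> head E e = v"
  using one_vertex tail_in_verts head_in_verts by blast+

text \<open>
  Every edge starts at the only vertex, so the blocks partition the whole set of edges.
\<close>

lemma blocks: "partition_on (arcs E) (C v)"
proof -
  have "out_arcs E v = arcs E"
    using tail_eq by (auto simp: out_arcs_def)
  then show ?thesis using partition [of v] one_vertex by simp
qed

lemma block_edge: "X \<in> C v \<Longrightarrow> e \<in> X \<Longrightarrow> e \<in> arcs E"
  using blocks by (auto simp: partition_on_def)

text \<open>
  The vertex is an identity on the generators: this is what (V), (E1) and (E2) say when all sources
  and ranges are equal to it.
\<close>

lemma presentation:
  "algebra_presentation (lpa_gens E) (lists (lpa_gens E) - {[]})
     (lpa_rels E C :: (_ \<Rightarrow> 'k::field) set) (word [Vert v])"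
proof
  let ?F = "word_algebra (lists (lpa_gens E) - {[]}) :: ('k, _) module"
  show "lpa_rels E C \<subseteq> carrier ?F"
  proof
    fix r :: "('v, 'e) lpa_gen list \<Rightarrow> 'k"
    assume "r \<in> lpa_rels E C"
    then show "r \<in> carrier ?F"
      by cases
        (auto intro!: word_algebra_diff word_algebra_sum
          simp: lpa_gens_def one_vertex tail_eq head_eq block_edge)
  qed
  show "word [Vert v] \<in> carrier ?F"
    by (simp add: lpa_gens_def one_vertex)
  show "convolution (word [Vert v]) (word [g]) - word [g] \<in> algebra_ideal ?F (lpa_rels E C)"
    if "g \<in> lpa_gens E" for g
  proof -
    have "word [Vert v, g] - word [g] \<in> (lpa_rels E C :: (_ \<Rightarrow> 'k) set)"
      using that lpa_rels.V [of v E v C] lpa_rels.E1_source [of _ E C] lpa_rels.E2_range [of _ E C]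
      by (auto simp: lpa_gens_def one_vertex tail_eq head_eq)
    then show ?thesis
      by (simp add: convolution_word algebra_ideal.generator)
  qed
  show "convolution (word [g]) (word [Vert v]) - word [g] \<in> algebra_ideal ?F (lpa_rels E C)"
    if "g \<in> lpa_gens E" for g
  proof -
    have "word [g, Vert v] - word [g] \<in> (lpa_rels E C :: (_ \<Rightarrow> 'k) set)"
      using that lpa_rels.V [of v E v C] lpa_rels.E1_range [of _ E C] lpa_rels.E2_source [of _ E C]
      by (auto simp: lpa_gens_def one_vertex tail_eq head_eq)
    then show ?thesis
      by (simp add: convolution_word algebra_ideal.generator)
  qed
qed simp

lemma leavitt_path_algebra_eq:
  "leavitt_path_algebra E C =
     algebra_presentation.P (lists (lpa_gens E) - {[]})
       (lpa_rels E C :: (_ \<Rightarrow> 'k::field) set) (word [Vert v])"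
proof -
  interpret L: algebra_presentation "lpa_gens E" "lists (lpa_gens E) - {[]}"
    "lpa_rels E C :: (_ \<Rightarrow> 'k) set" "word [Vert v]"
    by (rule presentation)
  show ?thesis
    by (simp add: leavitt_path_algebra_def L.P_def L.I_def L.cls_def Let_def one_vertex)
qed

lemma lpa_class_eq:
  "lpa_class E C g =
     algebra_presentation.cls (lists (lpa_gens E) - {[]})
       (lpa_rels E C :: (_ \<Rightarrow> 'k::field) set) (word [g])"
proof -
  interpret L: algebra_presentation "lpa_gens E" "lists (lpa_gens E) - {[]}"
    "lpa_rels E C :: (_ \<Rightarrow> 'k) set" "word [Vert v]"
    by (rule presentation)
  show ?thesis
    by (simp add: lpa_class_def L.I_def L.cls_def Let_def)
qed

lemma unital_algebra_lpa:
  "unital_algebra (leavitt_path_algebra E C :: ('k::field, _) module)"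
  unfolding leavitt_path_algebra_eq
  by (rule algebra_presentation.P_unital_algebra [OF presentation])

lemma leavitt_family_lpa:
  assumes X: "X \<in> C v"
  shows "leavitt_family (leavitt_path_algebra E C :: ('k::field, _) module) X
    (\<lambda>e. lpa_class E C (Edge e)) (\<lambda>e. lpa_class E C (Ghost e))"
proof -
  interpret L: algebra_presentation "lpa_gens E" "lists (lpa_gens E) - {[]}"
    "lpa_rels E C :: (_ \<Rightarrow> 'k) set" "word [Vert v]"
    by (rule presentation)
  interpret P: unital_algebra L.P by (rule L.P_unital_algebra)
  have F: "Edge e \<in> lpa_gens E" "Ghost e \<in> lpa_gens E" if "e \<in> X" for e
    using block_edge [OF X that] by (auto simp: lpa_gens_def)
  have "L.cls (word [Ghost e]) \<otimes>\<^bsub>L.P\<^esub> L.cls (word [Edge e']) =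
      (if e = e' then \<one>\<^bsub>L.P\<^esub> else \<zero>\<^bsub>L.P\<^esub>)" if "e \<in> X" "e' \<in> X" for e e'
    using L.relation_holds [OF lpa_rels.SCK1 [of v E X C e e']] that X
    by (simp add: L.mult_P F convolution_word L.one_P L.zero_P one_vertex
        head_eq block_edge split: if_splits)
  moreover have "(\<Oplus>\<^bsub>L.P\<^esub>e\<in>X. L.cls (word [Edge e]) \<otimes>\<^bsub>L.P\<^esub> L.cls (word [Ghost e])) = \<one>\<^bsub>L.P\<^esub>"
    if "finite X"
  proof -
    have "(\<Oplus>\<^bsub>L.P\<^esub>e\<in>X. L.cls (word [Edge e]) \<otimes>\<^bsub>L.P\<^esub> L.cls (word [Ghost e])) =
        (\<Oplus>\<^bsub>L.P\<^esub>e\<in>X. L.cls (word [Edge e, Ghost e]))"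
      by (intro P.finsum_cong') (auto simp: L.mult_P F convolution_word L.carrier_P)
    also have "\<dots> = L.cls (\<Sum>e\<in>X. word [Edge e, Ghost e])"
      using that F by (intro L.cls_sum) auto
    also have "\<dots> = \<one>\<^bsub>L.P\<^esub>"
      using L.relation_holds [OF lpa_rels.SCK2 [of v E X C]] that X
      by (simp add: L.one_P one_vertex)
    finally show ?thesis .
  qed
  ultimately show ?thesis
    unfolding leavitt_family_def leavitt_path_algebra_eq lpa_class_eq
    using F by (auto simp: L.carrier_P)
qed

text \<open>
  Sending the vertex to the identity makes (V), (E1) and (E2) hold automatically, which leaves the
  relations of the individual blocks.
\<close>

lemma lpa_hom:
  fixes B :: "('k::field, 'b) module"
  assumes "unital_algebra B" and family: "\<And>X. X \<in> C v \<Longrightarrow> leavitt_family B X a b"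
  obtains h where "h \<in> algebra_hom (leavitt_path_algebra E C) B"
    "\<And>e. e \<in> arcs E \<Longrightarrow> h (lpa_class E C (Edge e)) = a e"
    "\<And>e. e \<in> arcs E \<Longrightarrow> h (lpa_class E C (Ghost e)) = b e"
proof -
  interpret L: algebra_presentation "lpa_gens E" "lists (lpa_gens E) - {[]}"
    "lpa_rels E C :: (_ \<Rightarrow> 'k) set" "word [Vert v]"
    by (rule presentation)
  interpret B: unital_algebra B by fact
  define \<phi> where "\<phi> = case_lpa_gen (\<lambda>_ :: 'v. \<one>\<^bsub>B\<^esub>) a b"
  have \<phi>_simps: "\<phi> (Vert w) = \<one>\<^bsub>B\<^esub>" "\<phi> (Edge e) = a e" "\<phi> (Ghost e) = b e" for w e
    by (simp_all add: \<phi>_def)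
  have ab: "a e \<in> carrier B" "b e \<in> carrier B" if "e \<in> arcs E" for e
  proof -
    from that blocks obtain X where "X \<in> C v" "e \<in> X"
      by (auto simp: partition_on_def)
    with family [of X] show "a e \<in> carrier B" "b e \<in> carrier B"
      by (auto simp: leavitt_family_def)
  qed
  have \<phi>: "\<phi> g \<in> carrier B" if "g \<in> lpa_gens E" for g
    using that ab by (auto simp: lpa_gens_def \<phi>_simps)
  note ev = B.evaluate_diff [of "lpa_gens E", OF \<phi>] B.evaluate_word [of "lpa_gens E", OF \<phi>]
    B.evaluate_zero [of "lpa_gens E", OF \<phi>]
    B.evaluate_sum [of "lpa_gens E", OF \<phi>] word_algebra_sum B.minus_eq B.r_neg
  have gens: "Vert v \<in> lpa_gens E" "e \<in> arcs E \<Longrightarrow> Edge e \<in> lpa_gens E"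
    "e \<in> arcs E \<Longrightarrow> Ghost e \<in> lpa_gens E" for e
    by (auto simp: lpa_gens_def one_vertex)
  have "evaluate B \<phi> r = \<zero>\<^bsub>B\<^esub>" if "r \<in> lpa_rels E C" for r
    using that
  proof cases
    case (SCK1 w X e e')
    then have X: "X \<in> C v" by (simp add: one_vertex)
    with SCK1 block_edge have arcs: "e \<in> arcs E" "e' \<in> arcs E" by auto
    then show ?thesis
      using SCK1 family [OF X] by (auto simp: ev gens ab head_eq \<phi>_simps leavitt_family_def)
  next
    case (SCK2 w X)
    then have X: "X \<in> C v" by (simp add: one_vertex)
    have arcs: "e \<in> arcs E" if "e \<in> X" for e
      using block_edge [OF X that] .
    have "evaluate B \<phi> (\<Sum>e\<in>X. word [Edge e, Ghost e]) =
        (\<Oplus>\<^bsub>B\<^esub>e\<in>X. evaluate B \<phi> (word [Edge e, Ghost e]))"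
      using SCK2 arcs by (intro ev) (simp_all add: gens)
    also have "\<dots> = (\<Oplus>\<^bsub>B\<^esub>e\<in>X. a e \<otimes>\<^bsub>B\<^esub> b e)"
      using arcs by (intro B.finsum_cong') (auto simp: ev gens ab \<phi>_simps)
    also have "\<dots> = \<one>\<^bsub>B\<^esub>"
      using SCK2 family [OF X] by (simp add: leavitt_family_def)
    finally show ?thesis
      using SCK2 arcs by (simp add: ev(1,2) B.minus_eq B.r_neg word_algebra_sum gens one_vertex \<phi>_simps)
  qed (auto simp: ev gens ab one_vertex head_eq tail_eq \<phi>_simps)
  moreover have "evaluate B \<phi> (word [Vert v]) = \<one>\<^bsub>B\<^esub>"
    by (simp add: ev gens \<phi>_simps)
  ultimately obtain h where "h \<in> algebra_hom L.P B"
    "\<And>g. g \<in> lpa_gens E \<Longrightarrow> h (L.cls (word [g])) = \<phi> g"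
    using L.universal_hom [OF assms(1), of \<phi>] \<phi> by blast
  then show ?thesis
    using that [of h] by (simp add: leavitt_path_algebra_eq lpa_class_eq \<phi>_simps gens)
qed

text \<open>
  The vertex is the identity element, on which unital homomorphisms agree anyway.
\<close>

lemma lpa_hom_unique:
  fixes B :: "('k::field, 'b) module"
  assumes "unital_algebra B"
    and h: "h \<in> algebra_hom (leavitt_path_algebra E C) B"
    and k: "k \<in> algebra_hom (leavitt_path_algebra E C) B"
    and edge: "\<And>e. e \<in> arcs E \<Longrightarrow> h (lpa_class E C (Edge e)) = k (lpa_class E C (Edge e))"
    and ghost: "\<And>e. e \<in> arcs E \<Longrightarrow> h (lpa_class E C (Ghost e)) = k (lpa_class E C (Ghost e))"
    and "x \<in> carrier (leavitt_path_algebra E C)"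
  shows "h x = k x"
proof -
  interpret L: algebra_presentation "lpa_gens E" "lists (lpa_gens E) - {[]}"
    "lpa_rels E C :: (_ \<Rightarrow> 'k) set" "word [Vert v]"
    by (rule presentation)
  have "h (L.cls (word [Vert v])) = k (L.cls (word [Vert v]))"
    using algebra_homD(4) [OF h] algebra_homD(4) [OF k]
    by (simp add: leavitt_path_algebra_eq L.one_P)
  then show ?thesis
    using assms unfolding leavitt_path_algebra_eq lpa_class_eq
    by (intro L.hom_unique [of B h k x]) (auto simp: lpa_gens_def one_vertex)
qed

end

lemma one_vertex_graph_rose:
  assumes "X \<noteq> {}"
  shows "one_vertex_graph (rose (card_of X)) (\<lambda>_. {X}) ()"
  using separated_graph_rose [of "card_of X"] assms
  by (auto simp: one_vertex_graph_def one_vertex_graph_axioms_def Field_card_of rose_def)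

lemma leavitt_algebra_card_of:
  "leavitt_algebra (card_of X) = leavitt_path_algebra (rose (card_of X)) (\<lambda>_. {X})"
  by (simp add: leavitt_algebra_def Field_card_of)

lemma arcs_rose: "arcs (rose (card_of X)) = X"
  by (simp add: rose_def Field_card_of)


section \<open>The isomorphism\<close>

theorem proposition2p10:
  fixes E :: "('v, 'e) pre_digraph" and C :: "'v \<Rightarrow> 'e set set"
  assumes "separated_graph E C"
    and "card (verts E) = 1"
  shows "(leavitt_path_algebra E C :: ('k::field, (('v, 'e) lpa_gen list \<Rightarrow> 'k) set) module)
    \<cong>\<^sub>a\<^sub>l\<^sub>g free_product (\<Union>v\<in>verts E. C v) (\<lambda>X. leavitt_algebra (card_of X))"
proof -
  from assms(2) obtain v where v: "verts E = {v}"
    by (auto simp: card_1_singleton_iff)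
  interpret one_vertex_graph E C v
    using assms(1) v by (simp add: one_vertex_graph_def one_vertex_graph_axioms_def)
  define L where "L = (leavitt_path_algebra E C :: ('k, (('v, 'e) lpa_gen list \<Rightarrow> 'k) set) module)"
  define A where "A = (\<lambda>X. leavitt_algebra (card_of X) ::
    ('k, ((unit, 'e) lpa_gen list \<Rightarrow> 'k) set) module)"
  define Q where "Q = free_product (C v) A"
  define edge where "edge e = (lpa_class E C (Edge e) :: (_ \<Rightarrow> 'k) set)" for e
  define ghost where "ghost e = (lpa_class E C (Ghost e) :: (_ \<Rightarrow> 'k) set)" for e
  define edge' where "edge' X e = (lpa_class (rose (card_of X)) (\<lambda>_. {X}) (Edge e) :: (_ \<Rightarrow> 'k) set)"
    for X :: "'e set" and e
  define ghost' where "ghost' X e = (lpa_class (rose (card_of X)) (\<lambda>_. {X}) (Ghost e) :: (_ \<Rightarrow> 'k) set)"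
    for X :: "'e set" and e
  define \<iota> where "\<iota> = free_product_inj (C v) A"
  have rose: "one_vertex_graph (rose (card_of X)) (\<lambda>_. {X}) ()" if "X \<in> C v" for X
    using that blocks by (intro one_vertex_graph_rose) (auto simp: partition_on_def)
  have A_eq: "A X = leavitt_path_algebra (rose (card_of X)) (\<lambda>_. {X})" for X
    by (simp add: A_def leavitt_algebra_card_of)
  have L: "unital_algebra L"
    unfolding L_def by (rule unital_algebra_lpa)
  have A: "unital_algebra (A X)" if "X \<in> C v" for X
    unfolding A_eq by (rule one_vertex_graph.unital_algebra_lpa [OF rose [OF that]])
  interpret Q: unital_algebra_family "C v" A
    by (rule unital_algebra_family.intro) (rule A)
  have Q: "unital_algebra Q"
    unfolding Q_def by (rule Q.unital_algebra_free_product)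
  have \<iota>: "\<iota> X \<in> algebra_hom (A X) Q" if "X \<in> C v" for X
    unfolding \<iota>_def Q_def by (rule Q.free_product_inj_hom [OF that])
  have family: "leavitt_family L X edge ghost" if "X \<in> C v" for X
    using leavitt_family_lpa [OF that] by (simp add: L_def edge_def [abs_def] ghost_def [abs_def])
  have family': "leavitt_family (A X) X (edge' X) (ghost' X)" if "X \<in> C v" for X
    using one_vertex_graph.leavitt_family_lpa [OF rose [OF that], of X]
    by (simp add: A_eq edge'_def [abs_def] ghost'_def [abs_def])

  \<comment> \<open>The block that contains a given edge tells to which factor of the free product it is sent.\<close>
  obtain block where block: "\<And>e. e \<in> arcs E \<Longrightarrow> block e \<in> C v \<and> e \<in> block e"
  proof -
    have "\<forall>e\<in>arcs E. \<exists>X. X \<in> C v \<and> e \<in> X"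
      using blocks by (auto simp: partition_on_def)
    then obtain block where "\<forall>e\<in>arcs E. block e \<in> C v \<and> e \<in> block e"
      by (rule bchoice [THEN exE])
    then show thesis
      by (intro that [of block]) blast
  qed
  have block_eq: "block e = X" if "X \<in> C v" "e \<in> X" for e X
    using block [OF block_edge [OF that]] that blocks
    by (auto simp: partition_on_def disjoint_def)

  \<comment> \<open>On the block \<open>X\<close>, the chosen elements are the images of the generators of \<open>A X\<close>.\<close>
  have "leavitt_family Q X (\<lambda>e. \<iota> (block e) (edge' (block e) e))
      (\<lambda>e. \<iota> (block e) (ghost' (block e) e))" if X: "X \<in> C v" for X
    by (rule leavitt_family_hom [OF A [OF X] Q \<iota> [OF X] family' [OF X]])
      (simp_all add: block_eq [OF X])
  then obtain \<Phi> where \<Phi>: "\<Phi> \<in> algebra_hom L Q"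
    "\<And>e. e \<in> arcs E \<Longrightarrow> \<Phi> (edge e) = \<iota> (block e) (edge' (block e) e)"
    "\<And>e. e \<in> arcs E \<Longrightarrow> \<Phi> (ghost e) = \<iota> (block e) (ghost' (block e) e)"
    using lpa_hom [OF Q, of "\<lambda>e. \<iota> (block e) (edge' (block e) e)"
        "\<lambda>e. \<iota> (block e) (ghost' (block e) e)"]
    unfolding L_def edge_def ghost_def by blast

  have "\<exists>\<alpha> \<in> algebra_hom (A X) L. \<forall>e\<in>X. \<alpha> (edge' X e) = edge e \<and> \<alpha> (ghost' X e) = ghost e"
    if X: "X \<in> C v" for X
  proof -
    have "leavitt_family L Y edge ghost" if "Y \<in> {X}" for Y
      using that family X by simp
    then show ?thesis
      using one_vertex_graph.lpa_hom [OF rose [OF X] L, of edge ghost]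
      unfolding A_eq arcs_rose edge'_def ghost'_def by metis
  qed
  then obtain \<alpha> where \<alpha>: "\<And>X. X \<in> C v \<Longrightarrow> \<alpha> X \<in> algebra_hom (A X) L"
    "\<And>X e. X \<in> C v \<Longrightarrow> e \<in> X \<Longrightarrow> \<alpha> X (edge' X e) = edge e"
    "\<And>X e. X \<in> C v \<Longrightarrow> e \<in> X \<Longrightarrow> \<alpha> X (ghost' X e) = ghost e"
    by metis
  obtain \<Psi> where \<Psi>: "\<Psi> \<in> algebra_hom Q L"
    "\<And>X x. X \<in> C v \<Longrightarrow> x \<in> carrier (A X) \<Longrightarrow> \<Psi> (\<iota> X x) = \<alpha> X x"
    using Q.free_product_hom [OF L, of \<alpha>] \<alpha>(1) unfolding Q_def \<iota>_def by blast

  have gens': "edge' X e \<in> carrier (A X)" "ghost' X e \<in> carrier (A X)" if "X \<in> C v" "e \<in> X" for X e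
    using family' [OF that(1)] that(2) by (auto simp: leavitt_family_def)

  have "\<Psi> (\<Phi> x) = x" if "x \<in> carrier L" for x
  proof -
    have "(\<Psi> \<circ> \<Phi>) x = id x"
    proof (rule lpa_hom_unique [OF L, of "\<Psi> \<circ> \<Phi>" id x])
      show "\<Psi> \<circ> \<Phi> \<in> algebra_hom (leavitt_path_algebra E C) L"
        using algebra_hom_comp [OF \<Phi>(1) \<Psi>(1)] by (simp add: L_def)
      show "id \<in> algebra_hom (leavitt_path_algebra E C) L"
        unfolding L_def by (rule algebra_hom_id)
    qed (use that block \<Phi> \<Psi> \<alpha> gens' in \<open>auto simp: L_def edge_def ghost_def\<close>)
    then show ?thesis by simp
  qed
  \<comment> \<open>It suffices to compare on each factor, and there on the generators of the Leavitt algebra.\<close>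
  moreover have "\<Phi> (\<Psi> y) = y" if "y \<in> carrier Q" for y
  proof -
    have \<Phi>\<alpha>: "(\<Phi> \<circ> \<alpha> X) x = \<iota> X x" if X: "X \<in> C v" and x: "x \<in> carrier (A X)" for X x
    proof (rule one_vertex_graph.lpa_hom_unique
        [OF rose [OF X] Q, of "\<Phi> \<circ> \<alpha> X" "\<iota> X" x])
      show "\<Phi> \<circ> \<alpha> X \<in> algebra_hom (leavitt_path_algebra (rose (card_of X)) (\<lambda>_. {X})) Q"
        using algebra_hom_comp [OF \<alpha>(1) [OF X] \<Phi>(1)] by (simp add: A_eq)
      show "\<iota> X \<in> algebra_hom (leavitt_path_algebra (rose (card_of X)) (\<lambda>_. {X})) Q"
        using \<iota> [OF X] by (simp add: A_eq)
      show "x \<in> carrier (leavitt_path_algebra (rose (card_of X)) (\<lambda>_. {X}))"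
        using x by (simp add: A_eq)
    qed (simp_all add: arcs_rose \<alpha>(2,3) [OF X] \<Phi>(2,3) block_edge [OF X] block_eq [OF X]
        flip: edge'_def ghost'_def)
    have "(\<Phi> \<circ> \<Psi>) y = id y"
    proof (rule Q.free_product_hom_unique [OF Q, of "\<Phi> \<circ> \<Psi>" id y])
      show "\<Phi> \<circ> \<Psi> \<in> algebra_hom (free_product (C v) A) Q"
        using algebra_hom_comp [OF \<Psi>(1) \<Phi>(1)] by (simp add: Q_def)
      show "id \<in> algebra_hom (free_product (C v) A) Q"
        unfolding Q_def by (rule algebra_hom_id)
      show "y \<in> carrier (free_product (C v) A)"
        using that by (simp add: Q_def)
    qed (use \<Psi>(2) \<Phi>\<alpha> in \<open>simp flip: \<iota>_def\<close>)
    then show ?thesis by simp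
  qed
  ultimately have "L \<cong>\<^sub>a\<^sub>l\<^sub>g Q"
    by (rule algebra_isomorphicI [OF \<Phi>(1) \<Psi>(1)])
  then show ?thesis
    by (simp add: L_def Q_def A_def v)
qed

end
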